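(* Among the flat Lie algebras on $\mathfrak g_{3,3}$ given in the list of the context: (i) the associative ones are exactly $\mathfrak h_{0,1}^{\lambda=1},\mathfrak h_{0,7}^{\lambda=-1}$; (ii) the Novikov ones are exactly $\mathfrak h_{0,1},\mathfrak h_{0,2}$; (iii) the bi-symmetric ones are exactly $\mathfrak h_{0,1}^{\lambda=1},\mathfrak h_{0,2},\mathfrak h_{0,7}^{\lambda=-1},\mathfrak h_{0,8}$; (iv) the complete ones are exactly $\mathfrak h_{0,1}^{\lambda=0},\mathfrak h_{0,6}$.
   Context: A flat Lie algebra is a real Lie algebra $\mathfrak g$ with a bilinear product $X\cdot Y=\nabla_XY$ such that $X\cdot Y-Y\cdot X=[X,Y]$ and $[X,Y]\cdot Z=X\cdot(Y\cdot Z)-Y\cdot(X\cdot Z)$. Put $R_X(Y)=Y\cdot X$ and $(X,Y,Z)=(X\cdot Y)\cdot Z-X\cdot(Y\cdot Z)$. It is associative if $(X,Y,Z)=0$ for all $X,Y,Z$; Novikov if $R_XR_Y=R_YR_X$ for all $X,Y$; bi-symmetric if $(X,Y,Z)=(X,Z,Y)$ for all $X,Y,Z$; complete if every $R_X$ is nilpotent. A superscript restricts the indicated parameter to the indicated value; parameters not mentioned take all admissible values. List on the Lie algebra $\mathfrak g_{3,3}$ with basis $e_1,e_2,e_3$ and nonzero brackets $[e_1,e_3]=e_1$, $[e_2,e_3]=e_2$ (only nonzero products $e_ie_j=e_i\cdot e_j$ given): $\mathfrak h_{0,1}$: $e_1e_3=\lambda e_1,\ e_2e_3=\lambda e_2,\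 e_3e_1=(\lambda-1)e_1,\ e_3e_2=(\lambda-1)e_2,\ e_3e_3=\lambda e_3$; $\lambda\in\mathbb R$. $\mathfrak h_{0,2}$: $e_1e_3=e_1,\ e_2e_3=e_2,\ e_3e_3=e_2+e_3$. $\mathfrak h_{0,3}$: $e_1e_3=\lambda e_1,\ e_3e_1=(\lambda-1)e_1,\ e_3e_2=-e_2,\ e_3e_3=\lambda e_3$; $\lambda\in\mathbb R\setminus\{0\}$. $\mathfrak h_{0,4}$: $e_1e_3=-e_1,\ e_3e_1=-2e_1,\ e_3e_2=-e_2,\ e_3e_3=e_2-e_3$. $\mathfrak h_{0,5}$: $e_1e_3=e_1,\ e_3e_2=-e_2,\ e_3e_3=e_1+e_3$. $\mathfrak h_{0,6}$: $e_2e_3=e_1,\ e_3e_1=-e_1,\ e_3e_2=e_1-e_2$. $\mathfrak h_{0,7}$: $e_3e_1=-e_1,\ e_3e_2=-e_2,\ e_3e_3=\lambda e_3$; $\lambda\in\mathbb R\setminus\{0\}$. $\mathfrak h_{0,8}$: $e_3e_1=-e_1,\ e_3e_2=-e_2,\ e_3e_3=e_1-e_3$. $\mathfrak h_{0,9}$: $e_2e_2=\varepsilon e_3,\ e_3e_1=-e_1,\ e_3e_2=-e_2,\ e_3e_3=-2e_3$; $\varepsilon=\pm1$. $\mathfrak h_{0,10}$: $e_1e_2=e_3,\ e_2e_1=e_3,\ e_3e_1=-e_1,\ e_3e_2=-e_2,\ e_3e_3=-2e_3$. $\mathfrak h_{0,11}$: $e_1e_1=\varepsilon_1e_3,\ e_2e_2=\varepsilon_2e_3,\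 e_3e_1=-e_1,\ e_3e_2=-e_2,\ e_3e_3=-2e_3$; $\varepsilon_1,\varepsilon_2=\pm1$. $\mathfrak h_{2,1}$: $e_1e_3=-e_1,\ e_2e_2=e_1,\ e_3e_1=-2e_1,\ e_3e_2=-e_2,\ e_3e_3=-e_3$. $\mathfrak h_{2,2}$: $e_2e_2=e_1,\ e_2e_3=e_2,\ e_3e_1=-e_1,\ e_3e_3=e_3$. *)

theory Defs
  imports "HOL-Analysis.Analysis"
begin

definition lie_bracket :: "('a::real_vector \<Rightarrow> 'a \<Rightarrow> 'a) \<Rightarrow> bool" where
  "lie_bracket b \<longleftrightarrow> bilinear b \<and> (\<forall>x. b x x = 0) \<and>
     (\<forall>x y z. b x (b y z) + b y (b z x) + b z (b x y) = 0)"

definition flat_lie_algebra ::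
    "('a::real_vector \<Rightarrow> 'a \<Rightarrow> 'a) \<Rightarrow> ('a \<Rightarrow> 'a \<Rightarrow> 'a) \<Rightarrow> bool" where
  "flat_lie_algebra b p \<longleftrightarrow> lie_bracket b \<and> bilinear p \<and>
     (\<forall>x y. p x y - p y x = b x y) \<and>
     (\<forall>x y z. p (b x y) z = p x (p y z) - p y (p x z))"

definition right_mult :: "('a \<Rightarrow> 'a \<Rightarrow> 'a) \<Rightarrow> 'a \<Rightarrow> 'a \<Rightarrow> 'a" where
  "right_mult p x = (\<lambda>y. p y x)"

definition associator :: "('a::ab_group_add \<Rightarrow> 'a \<Rightarrow> 'a) \<Rightarrow> 'a \<Rightarrow> 'a \<Rightarrow> 'a \<Rightarrow> 'a" where
  "associator p x y z = p (p x y) z - p x (p y z)"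

definition nilpotent_map :: "('a::zero \<Rightarrow> 'a) \<Rightarrow> bool" where
  "nilpotent_map f \<longleftrightarrow> (\<exists>n::nat. \<forall>x. (f ^^ n) x = 0)"

definition associative_product :: "('a::real_vector \<Rightarrow> 'a \<Rightarrow> 'a) \<Rightarrow> bool" where
  "associative_product p \<longleftrightarrow> (\<forall>x y z. associator p x y z = 0)"

definition novikov_product :: "('a::real_vector \<Rightarrow> 'a \<Rightarrow> 'a) \<Rightarrow> bool" where
  "novikov_product p \<longleftrightarrow>
     (\<forall>x y. right_mult p x \<circ> right_mult p y = right_mult p y \<circ> right_mult p x)"

definition bisymmetric_product :: "('a::real_vector \<Rightarrow> 'a \<Rightarrow> 'a) \<Rightarrow> bool" where
  "bisymmetric_product p \<longleftrightarrow> (\<forall>x y z. associator p x y z = associator p x z y)"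

definition complete_product :: "('a::real_vector \<Rightarrow> 'a \<Rightarrow> 'a) \<Rightarrow> bool" where
  "complete_product p \<longleftrightarrow> (\<forall>x. nilpotent_map (right_mult p x))"

abbreviation e :: "3 \<Rightarrow> real ^ 3" where
  "e i \<equiv> axis i 1"

text \<open>The bilinear map on the span of \<open>e 1, e 2, e 3\<close> sending \<open>(e i, e j)\<close> to \<open>c (i, j)\<close>.
  In the index type \<open>3\<close> one has \<open>3 = 0\<close>, and \<open>1, 2, 3\<close> are its three distinct elements.\<close>

definition table_product :: "(3 \<times> 3 \<Rightarrow> real ^ 3) \<Rightarrow> real ^ 3 \<Rightarrow> real ^ 3 \<Rightarrow> real ^ 3" where
  "table_product c x y = (\<Sum>i\<in>UNIV. \<Sum>j\<in>UNIV. (x $ i * y $ j) *\<^sub>R c (i, j))"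

definition g33_bracket :: "real ^ 3 \<Rightarrow> real ^ 3 \<Rightarrow> real ^ 3" where
  "g33_bracket = table_product ((\<lambda>_. 0)
     ((1,3) := e 1, (3,1) := - e 1, (2,3) := e 2, (3,2) := - e 2))"

text \<open>\<open>Hm_n\<close> names the entry \<open>h\<close> with index \<open>m,n\<close>; the constructor arguments are its parameters.\<close>

datatype entry =
    H0_1 real | H0_2 | H0_3 real | H0_4 | H0_5 | H0_6 | H0_7 real | H0_8
  | H0_9 real | H0_10 | H0_11 real real | H2_1 | H2_2

definition listed :: "entry set" where
  "listed =
     range H0_1 \<union> {H0_2} \<union> H0_3 ` (- {0}) \<union> {H0_4, H0_5, H0_6} \<union> H0_7 ` (- {0}) \<union> {H0_8} \<union>
     H0_9 ` {1, -1} \<union> {H0_10} \<union> {H0_11 \<epsilon>\<^sub>1 \<epsilon>\<^sub>2 |\<epsilon>\<^sub>1 \<epsilon>\<^sub>2. \<epsilon>\<^sub>1 \<in> {1, -1} \<and> \<epsilon>\<^sub>2 \<in> {1, -1}} \<union>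
     {H2_1, H2_2}"

fun table :: "entry \<Rightarrow> 3 \<times> 3 \<Rightarrow> real ^ 3" where
  "table (H0_1 l) = (\<lambda>_. 0)((1,3) := l *\<^sub>R e 1, (2,3) := l *\<^sub>R e 2,
     (3,1) := (l - 1) *\<^sub>R e 1, (3,2) := (l - 1) *\<^sub>R e 2, (3,3) := l *\<^sub>R e 3)"
| "table H0_2 = (\<lambda>_. 0)((1,3) := e 1, (2,3) := e 2, (3,3) := e 2 + e 3)"
| "table (H0_3 l) = (\<lambda>_. 0)((1,3) := l *\<^sub>R e 1, (3,1) := (l - 1) *\<^sub>R e 1,
     (3,2) := - e 2, (3,3) := l *\<^sub>R e 3)"
| "table H0_4 = (\<lambda>_. 0)((1,3) := - e 1, (3,1) := - 2 *\<^sub>R e 1, (3,2) := - e 2,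
     (3,3) := e 2 - e 3)"
| "table H0_5 = (\<lambda>_. 0)((1,3) := e 1, (3,2) := - e 2, (3,3) := e 1 + e 3)"
| "table H0_6 = (\<lambda>_. 0)((2,3) := e 1, (3,1) := - e 1, (3,2) := e 1 - e 2)"
| "table (H0_7 l) = (\<lambda>_. 0)((3,1) := - e 1, (3,2) := - e 2, (3,3) := l *\<^sub>R e 3)"
| "table H0_8 = (\<lambda>_. 0)((3,1) := - e 1, (3,2) := - e 2, (3,3) := e 1 - e 3)"
| "table (H0_9 \<epsilon>) = (\<lambda>_. 0)((2,2) := \<epsilon> *\<^sub>R e 3,
     (3,1) := - e 1, (3,2) := - e 2, (3,3) := - 2 *\<^sub>R e 3)"
| "table H0_10 = (\<lambda>_. 0)((1,2) := e 3, (2,1) := e 3,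
     (3,1) := - e 1, (3,2) := - e 2, (3,3) := - 2 *\<^sub>R e 3)"
| "table (H0_11 \<epsilon>\<^sub>1 \<epsilon>\<^sub>2) = (\<lambda>_. 0)((1,1) := \<epsilon>\<^sub>1 *\<^sub>R e 3, (2,2) := \<epsilon>\<^sub>2 *\<^sub>R e 3,
     (3,1) := - e 1, (3,2) := - e 2, (3,3) := - 2 *\<^sub>R e 3)"
| "table H2_1 = (\<lambda>_. 0)((1,3) := - e 1, (2,2) := e 1, (3,1) := - 2 *\<^sub>R e 1,
     (3,2) := - e 2, (3,3) := - e 3)"
| "table H2_2 = (\<lambda>_. 0)((2,2) := e 1, (2,3) := e 2, (3,1) := - e 1, (3,3) := e 3)"

definition entry_product :: "entry \<Rightarrow> real ^ 3 \<Rightarrow> real ^ 3 \<Rightarrow> real ^ 3" where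
  "entry_product h = table_product (table h)"

lemma table_product_basis: "table_product c (e i) (e j) = c (i, j)"
proof -
  have "(e i $ k * e j $ l) *\<^sub>R c (k, l) = (if l = j then if k = i then c (k, l) else 0 else 0)" for k l
    by (auto simp: axis_def)
  then show ?thesis
    unfolding table_product_def by simp
qed

lemma bilinear_table_product: "bilinear (table_product c)"
  unfolding bilinear_def
  by (intro conjI allI linearI; simp add: table_product_def sum.distrib scaleR_sum_right algebra_simps)

lemma g33_lie_bracket: "lie_bracket g33_bracket"
  unfolding lie_bracket_def g33_bracket_def
  by (simp add: bilinear_table_product)
     (simp add: table_product_def sum_3 vec_eq_iff forall_3 axis_def algebra_simps)

theorem listed_flat:
  assumes "h \<in> listed"
  shows "flat_lie_algebra g33_bracket (entry_product h)"
proof -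
  have "\<forall>x y. entry_product h x y - entry_product h y x = g33_bracket x y"
    by (cases h) (simp_all add: g33_bracket_def entry_product_def table_product_def
        sum_3 vec_eq_iff forall_3 axis_def algebra_simps)
  moreover have "\<forall>x y z. entry_product h (g33_bracket x y) z =
      entry_product h x (entry_product h y z) - entry_product h y (entry_product h x z)"
    by (cases h) (simp_all add: g33_bracket_def entry_product_def table_product_def
        sum_3 vec_eq_iff forall_3 axis_def algebra_simps)
  ultimately show ?thesis
    by (simp add: flat_lie_algebra_def g33_lie_bracket entry_product_def bilinear_table_product)
qed

end

theory Submission
  imports Defs
begin

text \<open>All negative cases are witnessed by the basis vectors \<open>e 3\<close>, \<open>e 3\<close>, \<open>e j\<close> with \<open>j = 1\<close> or
  \<open>j = 2\<close>, except for completeness: there, whenever the \<open>e 3\<close>-component of \<open>e 3 \<cdot> e 3\<close> is a nonzero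
  number \<open>c\<close>, the subspace spanned by \<open>e 1\<close> and \<open>e 2\<close> is invariant under right multiplication by
  \<open>e 3\<close>, which acts on the quotient as multiplication by \<open>c\<close>.\<close>

lemmas table_simps = entry_product_def table_product_def sum_3 vec_eq_iff forall_3 axis_def

lemma bisymmetric_if_associative:
  "associative_product p \<Longrightarrow> bisymmetric_product p"
  by (simp add: associative_product_def bisymmetric_product_def)

lemma novikov_product_iff: "novikov_product p \<longleftrightarrow> (\<forall>x y z. p (p z y) x = p (p z x) y)"
  by (auto simp: novikov_product_def right_mult_def fun_eq_iff)

lemma not_complete_product:
  assumes "\<And>y. p y (e 3) $ 3 = c * y $ 3" and "c \<noteq> 0"
  shows "\<not> complete_product p"
proof
  assume "complete_product p"
  then obtain n where n: "(right_mult p (e 3) ^^ n) x = 0" for x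
    unfolding complete_product_def nilpotent_map_def by blast
  have "(right_mult p (e 3) ^^ n) x $ 3 = c ^ n * x $ 3" for n x
    by (induction n) (simp_all add: right_mult_def assms)
  from this [of n "e 3"] n assms(2) show False
    by simp
qed

text \<open>A nilpotent endomorphism of a 3-dimensional space has vanishing cube, so the exponent 3
  suffices on \<open>real ^ 3\<close>.\<close>

lemma complete_product_cubeI:
  assumes "\<And>x y. p (p (p y x) x) x = 0"
  shows "complete_product p"
  unfolding complete_product_def nilpotent_map_def right_mult_def
  using assms by (intro allI exI [of _ 3]) (simp add: eval_nat_numeral)

lemma bisymmetric_entry_iff:
  assumes "h \<in> listed"
  shows "bisymmetric_product (entry_product h) \<longleftrightarrow> h \<in> {H0_1 1, H0_2, H0_7 (-1), H0_8}"
proof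
  assume *: "bisymmetric_product (entry_product h)"
  let ?A = "associator (entry_product h) (e 3)"
  \<comment> \<open>Both equations are needed: on \<open>H0_3 l\<close> the first forces
    \<open>l = 1\<close> and the second \<open>l = -1\<close>.\<close>
  have "?A (e 3) (e 1) = ?A (e 1) (e 3)" "?A (e 3) (e 2) = ?A (e 2) (e 3)"
    using * unfolding bisymmetric_product_def by blast+
  then show "h \<in> {H0_1 1, H0_2, H0_7 (-1), H0_8}"
    using assms by (cases h) (auto simp: listed_def associator_def table_simps algebra_simps)
next
  assume "h \<in> {H0_1 1, H0_2, H0_7 (-1), H0_8}"
  then show "bisymmetric_product (entry_product h)"
    unfolding bisymmetric_product_def associator_def
    by (elim insertE) (simp_all add: table_simps algebra_simps)
qed

lemma associative_entry_iff:
  assumes "h \<in> listed"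
  shows "associative_product (entry_product h) \<longleftrightarrow> h \<in> {H0_1 1, H0_7 (-1)}"
proof
  assume *: "associative_product (entry_product h)"
  \<comment> \<open>Bi-symmetry leaves four candidates. This associator is \<open>e 2\<close> on
    \<open>H0_2\<close> and \<open>e 1\<close> on \<open>H0_8\<close>, which discards both.\<close>
  then have "associator (entry_product h) (e 3) (e 3) (e 3) = 0"
    unfolding associative_product_def by blast
  moreover have "h \<in> {H0_1 1, H0_2, H0_7 (-1), H0_8}"
    using bisymmetric_if_associative [OF *] bisymmetric_entry_iff [OF assms] by blast
  ultimately show "h \<in> {H0_1 1, H0_7 (-1)}"
    by (auto simp: associator_def table_simps)
next
  assume "h \<in> {H0_1 1, H0_7 (-1)}"
  then show "associative_product (entry_product h)"
    unfolding associative_product_def associator_def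
    by (elim insertE) (simp_all add: table_simps algebra_simps)
qed

lemma novikov_entry_iff:
  assumes "h \<in> listed"
  shows "novikov_product (entry_product h) \<longleftrightarrow> h \<in> range H0_1 \<union> {H0_2}"
proof
  assume *: "novikov_product (entry_product h)"
  let ?p = "entry_product h"
  \<comment> \<open>Only the first equation excludes \<open>H2_2\<close>; only the second excludes
    \<open>H0_5\<close>.\<close>
  have "?p (?p (e 3) (e 3)) (e 1) = ?p (?p (e 3) (e 1)) (e 3)"
    "?p (?p (e 3) (e 3)) (e 2) = ?p (?p (e 3) (e 2)) (e 3)"
    using * unfolding novikov_product_iff by blast+
  then show "h \<in> range H0_1 \<union> {H0_2}"
    using assms by (cases h) (auto simp: listed_def table_simps)
next
  assume "h \<in> range H0_1 \<union> {H0_2}"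
  then show "novikov_product (entry_product h)"
    unfolding novikov_product_iff
    by (elim UnE insertE rangeE) (simp_all add: table_simps algebra_simps)
qed

lemma complete_entry_iff:
  assumes "h \<in> listed"
  shows "complete_product (entry_product h) \<longleftrightarrow> h \<in> {H0_1 0, H0_6}"
proof
  assume *: "complete_product (entry_product h)"
  let ?c = "table h (3, 3) $ 3"
  have "entry_product h y (e 3) $ 3 = ?c * y $ 3" for y
    by (cases h) (simp_all add: table_simps)
  then have "?c = 0"
    using * not_complete_product by blast
  \<comment> \<open>In \<open>H0_3 l\<close> and \<open>H0_7 l\<close> the number \<open>?c\<close>
    is \<open>l\<close>, nonzero by \<open>listed\<close>; at \<open>l = 0\<close> both tables would
    coincide with that of \<open>H0_1 0\<close>.\<close>
  then show "h \<in> {H0_1 0, H0_6}"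
    using assms by (cases h) (auto simp: listed_def axis_def)
next
  assume "h \<in> {H0_1 0, H0_6}"
  then show "complete_product (entry_product h)"
    \<comment> \<open>In both algebras every right multiplication is strictly triangular: it maps
      \<open>e 3\<close> into the span of \<open>e 1\<close> and \<open>e 2\<close>,
      \<open>e 2\<close> into that of \<open>e 1\<close>, and \<open>e 1\<close> to 0.\<close>
    by (intro complete_product_cubeI, elim insertE) (simp_all add: table_simps)
qed

theorem corollary5:
  shows "{h \<in> listed. associative_product (entry_product h)} = {H0_1 1, H0_7 (-1)} \<and>
    {h \<in> listed. novikov_product (entry_product h)} = range H0_1 \<union> {H0_2} \<and>
    {h \<in> listed. bisymmetric_product (entry_product h)} = {H0_1 1, H0_2, H0_7 (-1), H0_8} \<and>
    {h \<in> listed. complete_product (entry_product h)} = {H0_1 0, H0_6}"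
proof -
  have *: "{h \<in> listed. P h} = S"
    if "\<And>h. h \<in> listed \<Longrightarrow> P h \<longleftrightarrow> h \<in> S" "S \<subseteq> listed" for P S
    using that by blast
  show ?thesis
    by (intro conjI * associative_entry_iff novikov_entry_iff bisymmetric_entry_iff
        complete_entry_iff) (auto simp: listed_def)
qed

end
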